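(* Let $T$ be a finite tree of order at least two. Then $T$ is an SR-graph if and only if $T$ contains neither weak edges nor strong edges.
   Context: $\gamma(G)$ denotes the domination number of a finite simple graph $G$, and $\Gamma(G)$ the set of all minimum dominating sets of $G$. For an edge $e=uv$ of $G$, $G-e$ is the graph obtained by deleting $e$, and $G_e$ is the graph obtained by subdividing $e$: delete $e$, add a new vertex $w$ and the edges $uw$ and $wv$. A finite connected simple graph $G$ of order at least two is an SR-graph (sub-removable graph) if $\gamma(G-e)=\gamma(G_e)$ for every edge $e$ of $G$. For $D\subseteq V(G)$ and $u\in D$, the external private neighborhood of $u$ with respect to $D$ is $EPN(u,D)=N_G(u)\setminus N_G[D\setminus\{u\}]$, where $N_G(u)$ is the set of neighbors of $u$ and $N_G[X]$ is the set of vertices that are in $X$ or adjacent to a vertex of $X$. Edges are regarded as two-element sets of vertices; if $|e\cap D|=1$, then $e\cap D$ also denotes the unique end of $e$ in $D$, and $\overline{e\cap D}$ denotes the end of $e$ not in $D$. An edge $e$ of $G$ satisfies Teschner's Condition if for every $D\in\Gamma(G)$ we have $|e\cap D|=1$ and $\overline{e\cap D}\in EPN(e\cap D,D)$. An edge $e$ of a tree $T$ is a weak edge if $e\cap D=\emptyset$ for every $D\in\Gamma(T)$. It is a strong edge if $e$ satisfies Teschner's Condition and there exists $D\in\Gamma(T)$ such that $EPN(e\cap D,D)=\{\overline{e\cap D}\}$. *)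

theory Defs
  imports Main
begin

record 'a ugraph =
  verts :: "'a set"
  edges :: "'a set set"

definition finite_simple_graph :: "'a ugraph \<Rightarrow> bool" where
  "finite_simple_graph G \<longleftrightarrow>
     finite (verts G) \<and> (\<forall>e\<in>edges G. e \<subseteq> verts G \<and> card e = 2)"

definition connected_graph :: "'a ugraph \<Rightarrow> bool" where
  "connected_graph G \<longleftrightarrow> verts G \<noteq> {} \<and>
     (\<forall>u\<in>verts G. \<forall>v\<in>verts G. (u, v) \<in> {(x, y). {x, y} \<in> edges G}\<^sup>*)"

text \<open>A cycle is given by the list of its (at least three, pairwise distinct) vertices;
  the last vertex is joined back to the first.\<close>

definition is_cycle :: "'a ugraph \<Rightarrow> 'a list \<Rightarrow> bool" where
  "is_cycle G c \<longleftrightarrow> 3 \<le> length c \<and> distinct c \<and>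
     (\<forall>i<length c. {c ! i, c ! (Suc i mod length c)} \<in> edges G)"

definition is_tree :: "'a ugraph \<Rightarrow> bool" where
  "is_tree G \<longleftrightarrow> finite_simple_graph G \<and> connected_graph G \<and> (\<nexists>c. is_cycle G c)"

definition nbhd :: "'a ugraph \<Rightarrow> 'a \<Rightarrow> 'a set" where
  "nbhd G u = {v. {u, v} \<in> edges G}"

definition closed_nbhd :: "'a ugraph \<Rightarrow> 'a set \<Rightarrow> 'a set" where
  "closed_nbhd G X = X \<union> (\<Union>x\<in>X. nbhd G x)"

definition dominating_set :: "'a ugraph \<Rightarrow> 'a set \<Rightarrow> bool" where
  "dominating_set G D \<longleftrightarrow> D \<subseteq> verts G \<and> verts G \<subseteq> closed_nbhd G D"

definition domination_number :: "'a ugraph \<Rightarrow> nat" where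
  "domination_number G = Min (card ` {D. dominating_set G D})"

definition min_dominating_sets :: "'a ugraph \<Rightarrow> 'a set set" where
  "min_dominating_sets G = {D. dominating_set G D \<and> card D = domination_number G}"

definition EPN :: "'a ugraph \<Rightarrow> 'a \<Rightarrow> 'a set \<Rightarrow> 'a set" where
  "EPN G u D = nbhd G u - closed_nbhd G (D - {u})"

definition delete_edge :: "'a ugraph \<Rightarrow> 'a set \<Rightarrow> 'a ugraph" where
  "delete_edge G e = \<lparr>verts = verts G, edges = edges G - {e}\<rparr>"

text \<open>The new vertex is \<^term>\<open>None\<close>, so that it is fresh whatever the vertex type is;
  an old vertex \<open>v\<close> becomes \<open>Some v\<close>.\<close>

definition subdivide_edge :: "'a ugraph \<Rightarrow> 'a set \<Rightarrow> 'a option ugraph" where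
  "subdivide_edge G e =
     \<lparr>verts = insert None (Some ` verts G),
      edges = (\<lambda>f. Some ` f) ` (edges G - {e}) \<union> (\<lambda>x. {Some x, None}) ` e\<rparr>"

definition SR_graph :: "'a ugraph \<Rightarrow> bool" where
  "SR_graph G \<longleftrightarrow> finite_simple_graph G \<and> connected_graph G \<and> 2 \<le> card (verts G) \<and>
     (\<forall>e\<in>edges G.
        domination_number (delete_edge G e) = domination_number (subdivide_edge G e))"

text \<open>For an edge \<open>e\<close>, these denote its end in \<open>D\<close> and its end outside \<open>D\<close>;
  they are meaningful only if exactly one end of \<open>e\<close> lies in \<open>D\<close>.\<close>

definition end_in :: "'a set \<Rightarrow> 'a set \<Rightarrow> 'a" where
  "end_in e D = the_elem (e \<inter> D)"

definition end_out :: "'a set \<Rightarrow> 'a set \<Rightarrow> 'a" where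
  "end_out e D = the_elem (e - D)"

definition teschner_condition :: "'a ugraph \<Rightarrow> 'a set \<Rightarrow> bool" where
  "teschner_condition G e \<longleftrightarrow>
     (\<forall>D\<in>min_dominating_sets G. card (e \<inter> D) = 1 \<and> end_out e D \<in> EPN G (end_in e D) D)"

definition weak_edge :: "'a ugraph \<Rightarrow> 'a set \<Rightarrow> bool" where
  "weak_edge T e \<longleftrightarrow> e \<in> edges T \<and> (\<forall>D\<in>min_dominating_sets T. e \<inter> D = {})"

definition strong_edge :: "'a ugraph \<Rightarrow> 'a set \<Rightarrow> bool" where
  "strong_edge T e \<longleftrightarrow> e \<in> edges T \<and> teschner_condition T e \<and>
     (\<exists>D\<in>min_dominating_sets T. EPN T (end_in e D) D = {end_out e D})"

end

theory Submission imports Defs begin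

text \<open>Deleting or subdividing an edge \<open>e\<close> raises the domination number by at most one. It stays
  unchanged for deletion iff some minimum dominating set \<open>D\<close> violates Teschner's Condition at \<open>e\<close>,
  and for subdivision iff some \<open>D\<close> meeting \<open>e\<close> violates it or has the other end of \<open>e\<close> as the only
  external private neighbour of its end of \<open>e\<close>. So the two numbers differ with deletion being
  larger iff \<open>e\<close> is strong, and a weak edge makes subdivision larger. In a tree the converse of the
  latter holds as well: the parts of two minimum dominating sets, one disjoint from \<open>e\<close> and one
  meeting it, can be exchanged across the bridge \<open>e\<close>.\<close>

section \<open>Dominating sets and the domination number\<close>

lemma edge_simple:
  assumes "finite_simple_graph G" "{x, y} \<in> edges G"
  shows "x \<in> verts G" "y \<in> verts G" "x \<noteq> y"
proof -
  have "{x, y} \<subseteq> verts G \<and> card {x, y} = 2"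
    using assms unfolding finite_simple_graph_def by blast
  then show "x \<in> verts G" "y \<in> verts G" "x \<noteq> y"
    by auto
qed

lemma dominating_set_iff:
  "dominating_set G D \<longleftrightarrow>
     D \<subseteq> verts G \<and> (\<forall>x\<in>verts G. x \<in> D \<or> (\<exists>y\<in>D. {y, x} \<in> edges G))"
  by (auto simp: dominating_set_def closed_nbhd_def nbhd_def)

lemma finite_dominating_sets:
  "finite (verts G) \<Longrightarrow> finite {D. dominating_set G D}"
  by (rule finite_subset[of _ "Pow (verts G)"]) (auto simp: dominating_set_def)

lemma domination_number_le:
  "finite (verts G) \<Longrightarrow> dominating_set G D \<Longrightarrow> domination_number G \<le> card D"
  unfolding domination_number_def by (rule Min_le) (auto simp: finite_dominating_sets)

lemma ex_min_dominating_set: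
  assumes "finite (verts G)"
  obtains D where "D \<in> min_dominating_sets G"
proof -
  have "dominating_set G (verts G)"
    by (simp add: dominating_set_iff)
  then have "Min (card ` {D. dominating_set G D}) \<in> card ` {D. dominating_set G D}"
    by (intro Min_in) (auto simp: finite_dominating_sets assms)
  then show thesis
    using that by (auto simp: min_dominating_sets_def domination_number_def)
qed

lemma min_dominating_setI:
  "finite (verts G) \<Longrightarrow> dominating_set G D \<Longrightarrow> card D \<le> domination_number G
    \<Longrightarrow> D \<in> min_dominating_sets G"
  using domination_number_le[of G D] by (auto simp: min_dominating_sets_def)

lemma min_dominating_setD:
  assumes "D \<in> min_dominating_sets G"
  shows "dominating_set G D" "card D = domination_number G"
  using assms by (auto simp: min_dominating_sets_def)

section \<open>Teschner's Condition at a single vertex set\<close>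

text \<open>The body of \<open>teschner_condition\<close> for one fixed set, so that sets at which
  it fails can be quantified over separately.\<close>

definition teschner_at :: "'a ugraph \<Rightarrow> 'a set \<Rightarrow> 'a set \<Rightarrow> bool" where
  "teschner_at G e D \<longleftrightarrow> card (e \<inter> D) = 1 \<and> end_out e D \<in> EPN G (end_in e D) D"

lemma end_in_out:
  assumes "u \<in> D" "v \<notin> D"
  shows "end_in {u, v} D = u" "end_out {u, v} D = v"
proof -
  have "{u, v} \<inter> D = {u}" "{u, v} - D = {v}"
    using assms by auto
  then show "end_in {u, v} D = u" "end_out {u, v} D = v"
    by (simp_all add: end_in_def end_out_def)
qed

lemma card_edge_Int_eq_1:
  assumes "u \<noteq> v"
  shows "card ({u, v} \<inter> D) = 1 \<longleftrightarrow> (u \<in> D) \<noteq> (v \<in> D)"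
  using assms by (cases "u \<in> D"; cases "v \<in> D") auto

lemma EPN_iff:
  "x \<in> EPN G u D \<longleftrightarrow> {u, x} \<in> edges G \<and> x \<notin> D - {u} \<and> (\<forall>y\<in>D - {u}. {y, x} \<notin> edges G)"
  by (auto simp: EPN_def nbhd_def closed_nbhd_def)

text \<open>Splitting by which end lies in \<open>D\<close> removes \<open>end_in\<close> and
  \<open>end_out\<close>, and with them \<open>the_elem\<close>.\<close>

lemma teschner_at_iff:
  assumes "finite_simple_graph G" "{u, v} \<in> edges G"
  shows "teschner_at G {u, v} D \<longleftrightarrow>
    u \<in> D \<and> v \<notin> D \<and> v \<in> EPN G u D \<or> v \<in> D \<and> u \<notin> D \<and> u \<in> EPN G v D"
proof -
  have "u \<noteq> v"
    using assms edge_simple by metis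
  have "end_in {u, v} D = v" "end_out {u, v} D = u" if "v \<in> D" "u \<notin> D"
    using end_in_out[OF that] by (simp_all add: insert_commute)
  then show ?thesis
    using end_in_out[of u D v] unfolding teschner_at_def card_edge_Int_eq_1[OF \<open>u \<noteq> v\<close>]
    by (cases "u \<in> D"; cases "v \<in> D") simp_all
qed

section \<open>Dominating sets after deleting or subdividing an edge\<close>

lemma verts_delete_edge [simp]: "verts (delete_edge G e) = verts G"
  and edges_delete_edge [simp]: "edges (delete_edge G e) = edges G - {e}"
  by (simp_all add: delete_edge_def)

text \<open>Only an end of the edge can lose its domination, say \<open>v\<close>. This happens
  exactly if \<open>v\<close> lies outside \<open>D\<close> and \<open>u\<close> is its only
  neighbour in \<open>D\<close>, that is, if \<open>v\<close> is an external private neighbour of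
  \<open>u\<close>.\<close>

lemma dominating_set_delete_edge:
  assumes G: "finite_simple_graph G" and e: "{u, v} \<in> edges G"
  shows "dominating_set (delete_edge G {u, v}) D \<longleftrightarrow>
    dominating_set G D \<and> \<not> teschner_at G {u, v} D"
proof -
  have uv: "u \<noteq> v" "u \<in> verts G" "v \<in> verts G" "{v, u} \<in> edges G"
    using edge_simple[OF G e] e by (simp_all add: insert_commute)
  show ?thesis
  proof
    assume "dominating_set (delete_edge G {u, v}) D"
    then have D: "D \<subseteq> verts G"
      "\<And>x. x \<in> verts G \<Longrightarrow> x \<in> D \<or> (\<exists>y\<in>D. {y, x} \<in> edges G \<and> {y, x} \<noteq> {u, v})"
      by (auto simp: dominating_set_iff)
    then have "dominating_set G D"
      unfolding dominating_set_iff by blast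
    moreover have "\<not> teschner_at G {u, v} D"
      using D(2)[OF uv(2)] D(2)[OF uv(3)] uv(1)
      by (auto simp: teschner_at_iff[OF G e] EPN_iff doubleton_eq_iff)
    ultimately show "dominating_set G D \<and> \<not> teschner_at G {u, v} D"
      by blast
  next
    assume *: "dominating_set G D \<and> \<not> teschner_at G {u, v} D"
    have "x \<in> D \<or> (\<exists>y\<in>D. {y, x} \<in> edges G - {{u, v}})" if x: "x \<in> verts G" for x
    proof (rule ccontr)
      assume not: "\<not> ?thesis"
      obtain y where y: "y \<in> D" "{y, x} \<in> edges G"
        using * x not unfolding dominating_set_iff by blast
      with not have "y = u \<and> x = v \<or> y = v \<and> x = u"
        by (auto simp: doubleton_eq_iff)
      then show False
        using * not y uv(1) by (auto simp: teschner_at_iff[OF G e] EPN_iff doubleton_eq_iff)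
    qed
    with * show "dominating_set (delete_edge G {u, v}) D"
      by (simp add: dominating_set_iff)
  qed
qed

lemma edges_subdivide_edge [simp]:
  "{Some x, Some y} \<in> edges (subdivide_edge G e) \<longleftrightarrow> {x, y} \<in> edges G - {e}"
  "{None, Some y} \<in> edges (subdivide_edge G e) \<longleftrightarrow> y \<in> e"
  "{Some y, None} \<in> edges (subdivide_edge G e) \<longleftrightarrow> y \<in> e"
proof -
  have *: "{Some x, Some y} = Some ` f \<longleftrightarrow> {x, y} = f" for f
    using inj_image_eq_iff[OF inj_Some, of "{x, y}" f] by simp
  show "{Some x, Some y} \<in> edges (subdivide_edge G e) \<longleftrightarrow> {x, y} \<in> edges G - {e}"
    by (auto simp: subdivide_edge_def * doubleton_eq_iff image_iff)
  have **: "{None, Some y} \<noteq> Some ` f" for f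
    by auto
  show "{None, Some y} \<in> edges (subdivide_edge G e) \<longleftrightarrow> y \<in> e"
    using ** by (auto simp: subdivide_edge_def doubleton_eq_iff image_iff)
  then show "{Some y, None} \<in> edges (subdivide_edge G e) \<longleftrightarrow> y \<in> e"
    by (simp add: insert_commute)
qed

lemma verts_subdivide_edge [simp]:
  "verts (subdivide_edge G e) = insert None (Some ` verts G)"
  by (simp add: subdivide_edge_def)

text \<open>Without \<open>None\<close> in the set, the new vertex has to be dominated by an end of
  \<open>e\<close>, while the old vertices are adjacent to each other only along the edges other
  than \<open>e\<close>.\<close>

lemma dominating_set_subdivide_edge_old:
  "dominating_set (subdivide_edge G e) (Some ` S) \<longleftrightarrow>
     dominating_set (delete_edge G e) S \<and> e \<inter> S \<noteq> {}"
  by (auto simp: dominating_set_iff)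

text \<open>The new vertex dominates both ends of \<open>e\<close>. The remaining old vertices are
  not incident with \<open>e\<close> and hence keep all their neighbours, so \<open>edges G\<close>
  may stand here in place of \<open>edges G - {e}\<close>.\<close>

lemma dominating_set_subdivide_edge_new:
  "dominating_set (subdivide_edge G e) (insert None (Some ` S)) \<longleftrightarrow>
     S \<subseteq> verts G \<and> (\<forall>x\<in>verts G - e. x \<in> S \<or> (\<exists>y\<in>S. {y, x} \<in> edges G))"
  by (auto simp: dominating_set_iff)

lemma dominating_set_subdivide_edge_cases:
  assumes "finite (verts G)" "dominating_set (subdivide_edge G e) D"
  obtains (old) S where "card S = card D" "dominating_set (delete_edge G e) S" "e \<inter> S \<noteq> {}"
    | (new) S where "Suc (card S) = card D" "S \<subseteq> verts G"
        "\<forall>x\<in>verts G - e. x \<in> S \<or> (\<exists>y\<in>S. {y, x} \<in> edges G)"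
proof (cases "None \<in> D")
  case False
  then have D: "D = Some ` (Some -` D)"
    by (auto simp: image_iff) (metis option.exhaust)
  then have "card D = card (Some -` D)"
    by (metis card_image inj_Some)
  then show ?thesis
    using old[of "Some -` D"] assms(2) D dominating_set_subdivide_edge_old by metis
next
  case True
  then have "D = insert None (Some ` (Some -` D))"
    by (auto simp: image_iff)
  then obtain S where D: "D = insert None (Some ` S)"
    by blast
  then have S: "S \<subseteq> verts G" "\<forall>x\<in>verts G - e. x \<in> S \<or> (\<exists>y\<in>S. {y, x} \<in> edges G)"
    using assms(2) dominating_set_subdivide_edge_new[of G e S] by simp_all
  then have "finite S"
    using assms(1) finite_subset by blast
  then have "Suc (card S) = card D"
    by (simp add: D card_image)
  then show ?thesis
    using new S by blast
qed

section \<open>Both operations raise the domination number by at most one\<close>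

lemma domination_number_delete_edge_bounds:
  assumes G: "finite_simple_graph G" and e: "{u, v} \<in> edges G"
  shows "domination_number G \<le> domination_number (delete_edge G {u, v})"
    and "domination_number (delete_edge G {u, v}) \<le> Suc (domination_number G)"
proof -
  have fin: "finite (verts G)"
    using G by (simp add: finite_simple_graph_def)
  obtain D' where "D' \<in> min_dominating_sets (delete_edge G {u, v})"
    using ex_min_dominating_set[of "delete_edge G {u, v}"] fin by auto
  note D' = min_dominating_setD[OF this]
  show "domination_number G \<le> domination_number (delete_edge G {u, v})"
    using domination_number_le[OF fin, of D'] D' dominating_set_delete_edge[OF G e] by simp
  obtain D where D: "D \<in> min_dominating_sets G"
    using ex_min_dominating_set fin by blast
  have ve: "u \<in> verts G" "v \<in> verts G"
    using edge_simple[OF G e] by auto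
  \<comment> \<open>One end of the edge is added so that the condition fails: either both ends are
    now in \<open>E\<close>, or \<open>v\<close> is outside and already has a neighbour in
    \<open>D\<close>, which differs from the added \<open>u\<close>.\<close>
  define E where "E = (if u \<in> D then insert v D else insert u D)"
  have "dominating_set G E"
    using min_dominating_setD(1)[OF D] ve by (auto simp: dominating_set_iff E_def)
  moreover have "\<not> teschner_at G {u, v} E"
    using min_dominating_setD(1)[OF D] ve
    by (auto simp: teschner_at_iff[OF G e] E_def EPN_iff dominating_set_iff)
  ultimately have "dominating_set (delete_edge G {u, v}) E"
    using dominating_set_delete_edge[OF G e] by blast
  then have "domination_number (delete_edge G {u, v}) \<le> card E"
    by (intro domination_number_le) (simp_all add: fin)
  also have "\<dots> \<le> Suc (card D)"
    using finite_subset[OF _ fin, of D] min_dominating_setD(1)[OF D]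
    by (auto simp: E_def card_insert_if dominating_set_def)
  finally show "domination_number (delete_edge G {u, v}) \<le> Suc (domination_number G)"
    using min_dominating_setD(2)[OF D] by simp
qed

text \<open>For the lower bound, a new vertex in the dominating set is traded for \<open>u\<close>,
  which dominates itself and \<open>v\<close>. For the upper bound, the new vertex is added to a
  minimum dominating set of \<open>G\<close>.\<close>

lemma domination_number_subdivide_edge_bounds:
  assumes G: "finite_simple_graph G" and e: "{u, v} \<in> edges G"
  shows "domination_number G \<le> domination_number (subdivide_edge G {u, v})"
    and "domination_number (subdivide_edge G {u, v}) \<le> Suc (domination_number G)"
proof -
  have fin: "finite (verts G)"
    using G by (simp add: finite_simple_graph_def)
  obtain D' where D': "D' \<in> min_dominating_sets (subdivide_edge G {u, v})"
    using ex_min_dominating_set[of "subdivide_edge G {u, v}"] fin by auto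
  show "domination_number G \<le> domination_number (subdivide_edge G {u, v})"
    using fin min_dominating_setD(1)[OF D']
  proof (cases rule: dominating_set_subdivide_edge_cases)
    case (old S)
    then show ?thesis
      using domination_number_le[OF fin, of S] dominating_set_delete_edge[OF G e]
        min_dominating_setD(2)[OF D'] by simp
  next
    case (new S)
    then have "dominating_set G (insert u S)"
      using edge_simple[OF G e] e by (auto simp: dominating_set_iff)
    then have "domination_number G \<le> card (insert u S)"
      by (rule domination_number_le[OF fin])
    also have "\<dots> \<le> Suc (card S)"
      using fin new(2) finite_subset[of S "verts G"] by (simp add: card_insert_if)
    finally show ?thesis
      using new(1) min_dominating_setD(2)[OF D'] by simp
  qed
  obtain D where D: "D \<in> min_dominating_sets G"
    using ex_min_dominating_set fin by blast
  then have "finite D"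
    using fin finite_subset by (auto simp: min_dominating_sets_def dominating_set_def)
  then have "card (insert None (Some ` D)) = Suc (card D)"
    by (simp add: card_image)
  moreover have "dominating_set (subdivide_edge G {u, v}) (insert None (Some ` D))"
    using min_dominating_setD(1)[OF D] unfolding dominating_set_subdivide_edge_new
    by (simp add: dominating_set_iff)
  ultimately show "domination_number (subdivide_edge G {u, v}) \<le> Suc (domination_number G)"
    using domination_number_le[of "subdivide_edge G {u, v}"] fin min_dominating_setD(2)[OF D]
    by fastforce
qed

section \<open>When the domination number stays unchanged\<close>

lemma domination_number_delete_edge_eq_iff:
  assumes G: "finite_simple_graph G" and e: "{u, v} \<in> edges G"
  shows "domination_number (delete_edge G {u, v}) = domination_number G \<longleftrightarrow>
    (\<exists>D\<in>min_dominating_sets G. \<not> teschner_at G {u, v} D)"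
proof -
  have fin: "finite (verts G)" "finite (verts (delete_edge G {u, v}))"
    using G by (simp_all add: finite_simple_graph_def)
  obtain D where "D \<in> min_dominating_sets (delete_edge G {u, v})"
    using ex_min_dominating_set fin(2) by blast
  then show ?thesis
    using domination_number_le[OF fin(2)] domination_number_delete_edge_bounds(1)[OF G e]
    unfolding min_dominating_sets_def dominating_set_delete_edge[OF G e]
    by (metis (mono_tags, lifting) le_antisym mem_Collect_eq)
qed

text \<open>Apart from \<open>u\<close> itself, only \<open>v\<close> depends on \<open>u\<close>
  for its domination. The new vertex is adjacent to both, so it can replace \<open>u\<close> without
  changing the cardinality.\<close>

lemma subdivide_edge_dominated_by_new_vertex:
  assumes G: "finite_simple_graph G" and D: "D \<in> min_dominating_sets G"
    and "u \<in> D" "EPN G u D = {v}"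
  shows "domination_number (subdivide_edge G {u, v}) \<le> domination_number G"
proof -
  have fin: "finite (verts G)" and D': "dominating_set G D"
    using G D by (simp_all add: finite_simple_graph_def min_dominating_sets_def)
  have "finite D"
    using fin D' finite_subset by (auto simp: dominating_set_def)
  have "dominating_set (subdivide_edge G {u, v}) (insert None (Some ` (D - {u})))"
    unfolding dominating_set_subdivide_edge_new
  proof (intro conjI ballI)
    show "D - {u} \<subseteq> verts G"
      using D' by (auto simp: dominating_set_def)
    fix x assume x: "x \<in> verts G - {u, v}"
    then have "x \<notin> EPN G u D"
      using assms(4) by simp
    then show "x \<in> D - {u} \<or> (\<exists>y\<in>D - {u}. {y, x} \<in> edges G)"
      using x D' by (auto simp: EPN_iff dominating_set_iff)
  qed
  then have "domination_number (subdivide_edge G {u, v}) \<le> card (insert None (Some ` (D - {u})))"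
    by (intro domination_number_le) (simp_all add: fin)
  also have "\<dots> = Suc (card (D - {u}))"
    using \<open>finite D\<close> by (simp add: card_image)
  also have "\<dots> = card D"
    using \<open>finite D\<close> \<open>u \<in> D\<close> by (rule card_Suc_Diff1)
  finally show ?thesis
    using min_dominating_setD(2)[OF D] by simp
qed

lemma domination_number_subdivide_edge_eq_iff:
  assumes G: "finite_simple_graph G" and e: "{u, v} \<in> edges G"
  shows "domination_number (subdivide_edge G {u, v}) = domination_number G \<longleftrightarrow>
    (\<exists>D\<in>min_dominating_sets G. {u, v} \<inter> D \<noteq> {} \<and>
       (\<not> teschner_at G {u, v} D \<or> EPN G (end_in {u, v} D) D = {end_out {u, v} D}))"
    (is "?eq \<longleftrightarrow> ?ex")
proof
  have fin: "finite (verts G)"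
    using G by (simp add: finite_simple_graph_def)
  {
    assume ?eq
    obtain D' where D': "D' \<in> min_dominating_sets (subdivide_edge G {u, v})"
      using ex_min_dominating_set[of "subdivide_edge G {u, v}"] fin by auto
    show ?ex
      using fin min_dominating_setD(1)[OF D']
    proof (cases rule: dominating_set_subdivide_edge_cases)
      case (old S)
      then show ?thesis
        using dominating_set_delete_edge[OF G e] min_dominating_setD(2)[OF D'] \<open>?eq\<close>
        by (auto simp: min_dominating_sets_def)
    next
      case (new S)
      have "finite S"
        using new(2) fin finite_subset by blast
      have Suc: "Suc (card S) = domination_number G"
        using new(1) min_dominating_setD(2)[OF D'] \<open>?eq\<close> by simp
      have "\<not> dominating_set G S"
        using domination_number_le[OF fin, of S] Suc by auto
      \<comment> \<open>An end of the edge in \<open>S\<close> would dominate the other end, so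
        \<open>S\<close> would dominate \<open>G\<close> although it has one vertex too few. Hence
        \<open>S\<close> contains neither end.\<close>
      moreover have "dominating_set G S" if "u \<in> S \<or> v \<in> S"
        using that new(2,3) e unfolding dominating_set_iff by (auto simp: insert_commute)
      ultimately have S: "u \<notin> S" "v \<notin> S"
        by blast+
      let ?D = "insert u S"
      have D: "?D \<in> min_dominating_sets G"
      proof (rule min_dominating_setI[OF fin])
        show "dominating_set G ?D"
          using new(2,3) edge_simple[OF G e] e by (auto simp: dominating_set_iff)
        show "card ?D \<le> domination_number G"
          using Suc \<open>finite S\<close> S by simp
      qed
      have ends: "end_in {u, v} ?D = u" "end_out {u, v} ?D = v"
        using end_in_out[of u ?D v] S edge_simple[OF G e] by auto
      \<comment> \<open>\<open>S\<close> dominates every vertex other than the two ends, so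
        \<open>v\<close> is the only possible external private neighbour of
        \<open>u\<close>.\<close>
      have "EPN G u ?D \<subseteq> {v}"
      proof
        fix x assume "x \<in> EPN G u ?D"
        then have x: "{u, x} \<in> edges G" "x \<notin> S" "\<forall>y\<in>S. {y, x} \<notin> edges G"
          using S(1) by (auto simp: EPN_iff)
        then show "x \<in> {v}"
          using new(3) edge_simple[OF G x(1)] by auto
      qed
      \<comment> \<open>If the condition holds, \<open>v\<close> belongs to this set of private
        neighbours, which is then exactly \<open>{v}\<close>.\<close>
      then have "\<not> teschner_at G {u, v} ?D \<or> EPN G u ?D = {v}"
        unfolding teschner_at_def ends by blast
      then show ?thesis
        using D ends by (intro bexI[of _ ?D]) auto
    qed
  }
  assume ?ex
  then obtain D where D: "D \<in> min_dominating_sets G" "{u, v} \<inter> D \<noteq> {}"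
    "\<not> teschner_at G {u, v} D \<or> EPN G (end_in {u, v} D) D = {end_out {u, v} D}"
    by blast
  have "domination_number (subdivide_edge G {u, v}) \<le> domination_number G"
  proof (cases "teschner_at G {u, v} D")
    case False
    then have "dominating_set (subdivide_edge G {u, v}) (Some ` D)"
      using D(2) min_dominating_setD(1)[OF D(1)]
      by (simp add: dominating_set_subdivide_edge_old dominating_set_delete_edge[OF G e])
    then have "domination_number (subdivide_edge G {u, v}) \<le> card (Some ` D)"
      by (intro domination_number_le) (simp_all add: fin)
    then show ?thesis
      using min_dominating_setD(2)[OF D(1)] by (simp add: card_image)
  next
    case True
    then consider "u \<in> D" "v \<notin> D" | "v \<in> D" "u \<notin> D"
      unfolding teschner_at_iff[OF G e] by blast
    then show ?thesis
    proof cases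
      case 1
      then show ?thesis
        using subdivide_edge_dominated_by_new_vertex[OF G D(1)] D(3) True
        by (simp add: end_in_out)
    next
      case 2
      then have "EPN G v D = {u}"
        using D(3) True end_in_out[OF 2] by (simp add: insert_commute)
      then show ?thesis
        using subdivide_edge_dominated_by_new_vertex[OF G D(1) 2(1)] by (simp add: insert_commute)
    qed
  qed
  then show ?eq
    using domination_number_subdivide_edge_bounds(1)[OF G e] by simp
qed

section \<open>Exchange of dominating sets across a bridge\<close>

text \<open>\<open>A\<close> consists of the vertices that can be reached from \<open>u\<close>
  without using the edge. If \<open>v\<close> were among them, a shortest such walk together with
  the edge would form a cycle.\<close>

lemma tree_edge_is_bridge:
  assumes T: "is_tree T" and e: "{u, v} \<in> edges T"
  obtains A where "u \<in> A" "v \<notin> A"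
    "\<And>x y. {x, y} \<in> edges T \<Longrightarrow> x \<in> A \<Longrightarrow> y \<notin> A \<Longrightarrow> x = u \<and> y = v"
proof -
  define R where "R = {(x, y). {x, y} \<in> edges T - {{u, v}}}"
  have uv: "u \<noteq> v"
    using T e edge_simple(3) unfolding is_tree_def by metis
  have "(u, v) \<notin> R\<^sup>*"
  proof
    assume "(u, v) \<in> R\<^sup>*"
    then have ex: "\<exists>n. (u, v) \<in> R ^^ n"
      by (simp add: rtrancl_power)
    define n where "n = (LEAST n. (u, v) \<in> R ^^ n)"
    have "(u, v) \<in> R ^^ n"
      unfolding n_def using ex by (rule LeastI_ex)
    then obtain f where f: "f 0 = u" "f n = v" "\<And>i. i < n \<Longrightarrow> (f i, f (Suc i)) \<in> R"
      by (auto simp: relpow_fun_conv)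
    \<comment> \<open>A repeated vertex would allow the part of the walk between its occurrences to
      be cut out, against the minimality of \<open>n\<close>.\<close>
    have dist: "f i \<noteq> f j" if "i < j" "j \<le> n" for i j
    proof
      assume eq: "f i = f j"
      have "(u, f i) \<in> R ^^ i"
        using f that by (auto simp: relpow_fun_conv)
      moreover have "(f j, v) \<in> R ^^ (n - j)"
        unfolding relpow_fun_conv using f that
        by (intro exI[of _ "\<lambda>k. f (j + k)"]) auto
      ultimately have "(u, v) \<in> R ^^ (i + (n - j))"
        using eq by (auto simp: relpow_add)
      then have "n \<le> i + (n - j)"
        unfolding n_def by (rule Least_le)
      then show False
        using that by simp
    qed
    \<comment> \<open>A cycle needs three vertices. A walk of length 1 would consist of the deleted
      edge alone.\<close>
    have "n \<noteq> 0"
      using f(1,2) uv by metis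
    moreover have "n \<noteq> 1"
      using f(1,2) f(3)[of 0] by (auto simp: R_def)
    ultimately have "2 \<le> n"
      by simp
    let ?c = "map f [0..<Suc n]"
    have "distinct ?c"
      unfolding distinct_map
      by (auto simp: inj_on_def less_Suc_eq_le simp del: upt_Suc) (metis dist linorder_neqE_nat)
    \<comment> \<open>At \<open>i = n\<close> the edge between \<open>v\<close> and \<open>u\<close>
      closes the cycle; all other indices are steps of the walk.\<close>
    moreover have "{?c ! i, ?c ! (Suc i mod length ?c)} \<in> edges T" if "i < length ?c" for i
    proof (cases "i = n")
      case True
      then show ?thesis
        using f e by (simp add: insert_commute del: upt_Suc)
    next
      case False
      then show ?thesis
        using f(3)[of i] that by (simp add: R_def del: upt_Suc)
    qed
    ultimately have "is_cycle T ?c"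
      using \<open>2 \<le> n\<close> unfolding is_cycle_def by simp
    then show False
      using T by (auto simp: is_tree_def)
  qed
  moreover have "x = u \<and> y = v"
    if xy: "{x, y} \<in> edges T" "(u, x) \<in> R\<^sup>*" "(u, y) \<notin> R\<^sup>*" for x y
  proof -
    have "(x, y) \<notin> R"
      using xy rtrancl_into_rtrancl by metis
    then have "{x, y} = {u, v}"
      using xy by (simp add: R_def)
    moreover have "y \<noteq> u"
      using xy(3) by auto
    ultimately show ?thesis
      by (auto simp: doubleton_eq_iff)
  qed
  ultimately show thesis
    using that[of "{x. (u, x) \<in> R\<^sup>*}"] by auto
qed

lemma bridge_exchange:
  assumes G: "finite_simple_graph G" and e: "{u, v} \<in> edges G"
    and A: "u \<in> A" "v \<notin> A"
      "\<And>x y. {x, y} \<in> edges G \<Longrightarrow> x \<in> A \<Longrightarrow> y \<notin> A \<Longrightarrow> x = u \<and> y = v"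
    and D0: "D0 \<in> min_dominating_sets G" "u \<notin> D0" "v \<notin> D0"
    and D1: "D1 \<in> min_dominating_sets G" "u \<in> D1"
  shows "\<exists>D\<in>min_dominating_sets G. {u, v} \<inter> D \<noteq> {} \<and> \<not> teschner_at G {u, v} D"
proof -
  have fin: "finite (verts G)"
    using G by (simp add: finite_simple_graph_def)
  note dom0 = min_dominating_setD(1)[OF D0(1), unfolded dominating_set_iff]
  note dom1 = min_dominating_setD(1)[OF D1(1), unfolded dominating_set_iff]
  have finD: "finite D0" "finite D1"
    using dom0 dom1 fin finite_subset by blast+
  have uv: "u \<in> verts G" "v \<in> verts G" "u \<noteq> v"
    using edge_simple[OF G e] .
  \<comment> \<open>Since \<open>D0\<close> avoids both ends of the bridge, it dominates each vertex
    outside itself from that vertex's own side.\<close>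
  have in_A: "y \<in> A" if "y \<in> D0" "{y, x} \<in> edges G" "x \<in> A" for x y
    using A(3)[of x y] that D0 by (auto simp: insert_commute)
  have out_A: "y \<notin> A" if "y \<in> D0" "{y, x} \<in> edges G" "x \<notin> A" for x y
    using A(3)[of y x] that D0 by auto
  let ?X = "D1 \<inter> A \<union> (D0 - A)"
  \<comment> \<open>On the side of \<open>v\<close>, removing \<open>D1 \<inter> A\<close> can leave
    only \<open>v\<close> undominated, because \<open>D1\<close> may have dominated it through
    \<open>u\<close>. Adding \<open>v\<close> repairs this.\<close>
  let ?Y = "insert v (D0 \<inter> A \<union> (D1 - A))"
  have "x \<in> ?X \<or> (\<exists>y\<in>?X. {y, x} \<in> edges G)" if x: "x \<in> verts G" for x
  proof (cases "x \<in> A")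
    case True
    \<comment> \<open>Only \<open>u\<close> can be dominated from outside \<open>A\<close>, and
      \<open>u\<close> belongs to \<open>D1\<close>.\<close>
    have "x = u" if "y \<notin> A" "{y, x} \<in> edges G" for y
      using A(3)[of x y] that True by (simp add: insert_commute)
    then show ?thesis
      using dom1 x True D1 A(1) by blast
  next
    case False
    then show ?thesis
      using dom0 x out_A by blast
  qed
  then have domX: "dominating_set G ?X"
    using dom0 dom1 unfolding dominating_set_iff by blast
  have "x \<in> ?Y \<or> (\<exists>y\<in>?Y. {y, x} \<in> edges G)" if x: "x \<in> verts G" for x
  proof (cases "x \<in> A")
    case True
    then show ?thesis
      using dom0 x in_A by blast
  next
    case False
    have "x = v" if "y \<in> A" "{y, x} \<in> edges G" for y
      using A(3)[of y x] that False by simp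
    then show ?thesis
      using dom1 x False by blast
  qed
  then have domY: "dominating_set G ?Y"
    using dom0 dom1 uv unfolding dominating_set_iff by blast
  have split: "card D = card (D \<inter> A) + card (D - A)" if "finite D" for D
    using that by (metis card_Int_Diff)
  have cardX: "card ?X = card (D1 \<inter> A) + card (D0 - A)"
    using finD by (intro card_Un_disjoint) auto
  have "card ?Y \<le> Suc (card (D0 \<inter> A \<union> (D1 - A)))"
    using finD by (simp add: card_insert_if)
  also have "card (D0 \<inter> A \<union> (D1 - A)) = card (D0 \<inter> A) + card (D1 - A)"
    using finD by (intro card_Un_disjoint) auto
  finally have cardY: "card ?Y \<le> Suc (card (D0 \<inter> A) + card (D1 - A))" .
  have g: "card D0 = domination_number G" "card D1 = domination_number G"
    using D0 D1 min_dominating_setD(2) by blast+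
  show ?thesis
  proof (cases "card ?X \<le> domination_number G")
    case True
    \<comment> \<open>This neighbour of \<open>v\<close> lies on the side of \<open>v\<close>, so it
      survives in \<open>?X\<close>, and \<open>v\<close> is not private to
      \<open>u\<close>.\<close>
    obtain y where y: "y \<in> D0" "{y, v} \<in> edges G"
      using dom0 uv D0 by blast
    then have "y \<in> ?X" "y \<noteq> u"
      using out_A[OF y A(2)] D0(2) by auto
    then have "v \<notin> EPN G u ?X"
      using y(2) by (auto simp: EPN_iff)
    then have "\<not> teschner_at G {u, v} ?X"
      using D0 D1 A by (auto simp: teschner_at_iff[OF G e])
    moreover have "{u, v} \<inter> ?X \<noteq> {}"
      using D1 A by simp
    ultimately show ?thesis
      using min_dominating_setI[OF fin domX True] by (intro bexI[of _ ?X] conjI)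
  next
    case False
    then have "card ?Y \<le> domination_number G"
      using cardX cardY g split[OF finD(1)] split[OF finD(2)] by linarith
    then have Y: "?Y \<in> min_dominating_sets G"
      by (rule min_dominating_setI[OF fin domY])
    obtain y where y: "y \<in> D0" "{y, u} \<in> edges G"
      using dom0 uv D0 by blast
    then have "y \<in> ?Y" "y \<noteq> v"
      using in_A[OF y A(1)] D0(3) by auto
    then have "u \<notin> EPN G v ?Y"
      using y(2) by (auto simp: EPN_iff)
    then have "\<not> teschner_at G {u, v} ?Y"
      by (auto simp: teschner_at_iff[OF G e])
    then show ?thesis
      using Y by (intro bexI[of _ ?Y] conjI) simp_all
  qed
qed

text \<open>The edge is oriented so that its first end lies in \<open>D1\<close>, and the tree
  supplies the bridge side needed for \<open>bridge_exchange\<close>.\<close>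

lemma tree_edge_exchange:
  assumes T: "is_tree T" and e: "{u, v} \<in> edges T"
    and D0: "D0 \<in> min_dominating_sets T" "{u, v} \<inter> D0 = {}"
    and D1: "D1 \<in> min_dominating_sets T" "{u, v} \<inter> D1 \<noteq> {}"
  shows "\<exists>D\<in>min_dominating_sets T. {u, v} \<inter> D \<noteq> {} \<and> \<not> teschner_at T {u, v} D"
proof -
  have *: "\<exists>D\<in>min_dominating_sets T. {a, b} \<inter> D \<noteq> {} \<and> \<not> teschner_at T {a, b} D"
    if ab: "{a, b} \<in> edges T" "a \<notin> D0" "b \<notin> D0" "a \<in> D1" for a b
  proof -
    obtain A where A: "a \<in> A" "b \<notin> A"
      "\<And>x y. {x, y} \<in> edges T \<Longrightarrow> x \<in> A \<Longrightarrow> y \<notin> A \<Longrightarrow> x = a \<and> y = b"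
      using tree_edge_is_bridge[OF T ab(1)] by blast
    have "finite_simple_graph T"
      using T by (simp add: is_tree_def)
    then show ?thesis
      using bridge_exchange[OF _ ab(1) A D0(1) ab(2,3) D1(1) ab(4)] by blast
  qed
  show ?thesis
  proof (cases "u \<in> D1")
    case True
    then show ?thesis
      using *[of u v] e D0 by simp
  next
    case False
    then show ?thesis
      using *[of v u] e D0 D1 by (simp add: insert_commute)
  qed
qed

section \<open>Weak and strong edges as the two ways of failing equality\<close>

lemma tree_delete_eq_subdivide_iff:
  assumes T: "is_tree T" and e: "e \<in> edges T"
  shows "domination_number (delete_edge T e) = domination_number (subdivide_edge T e) \<longleftrightarrow>
    \<not> weak_edge T e \<and> \<not> strong_edge T e"
proof -
  have G: "finite_simple_graph T"
    using T by (simp add: is_tree_def)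
  then have "card e = 2" and fin: "finite (verts T)"
    using e by (auto simp: finite_simple_graph_def)
  then obtain u v where uv: "e = {u, v}"
    by (auto simp: card_2_iff)
  have e': "{u, v} \<in> edges T"
    using e uv by simp
  \<comment> \<open>\<open>P\<close> says that deletion preserves the domination number,
    \<open>Q\<close> that subdivision does.\<close>
  define P where "P \<longleftrightarrow> (\<exists>D\<in>min_dominating_sets T. \<not> teschner_at T e D)"
  define Q where "Q \<longleftrightarrow> (\<exists>D\<in>min_dominating_sets T. e \<inter> D \<noteq> {} \<and>
    (\<not> teschner_at T e D \<or> EPN T (end_in e D) D = {end_out e D}))"
  have meets: "e \<inter> D \<noteq> {}" if "teschner_at T e D" for D
    using that by (auto simp: teschner_at_def)
  \<comment> \<open>Each of the two numbers is the domination number of \<open>T\<close> or one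
    more, so they agree iff both or neither are unchanged.\<close>
  have "domination_number (delete_edge T e) = domination_number (subdivide_edge T e) \<longleftrightarrow> (P \<longleftrightarrow> Q)"
    using domination_number_delete_edge_eq_iff[OF G e']
      domination_number_subdivide_edge_eq_iff[OF G e']
      domination_number_delete_edge_bounds[OF G e']
      domination_number_subdivide_edge_bounds[OF G e']
    unfolding P_def Q_def uv by linarith
  moreover have "strong_edge T e \<longleftrightarrow> \<not> P \<and> Q"
  proof -
    have "strong_edge T e \<longleftrightarrow>
      \<not> P \<and> (\<exists>D\<in>min_dominating_sets T. EPN T (end_in e D) D = {end_out e D})"
      using e by (simp add: strong_edge_def teschner_condition_def P_def teschner_at_def)
    also have "\<dots> \<longleftrightarrow> \<not> P \<and> Q"
    \<comment> \<open>Under \<open>\<not> P\<close> every minimum dominating set satisfies the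
      condition and meets \<open>e\<close>, so only the clause on private neighbours in
      \<open>Q\<close> remains.\<close>
    proof (rule conj_cong[OF refl])
      assume "\<not> P"
      then have "\<forall>D\<in>min_dominating_sets T. teschner_at T e D \<and> e \<inter> D \<noteq> {}"
        using meets by (simp add: P_def)
      then show "(\<exists>D\<in>min_dominating_sets T. EPN T (end_in e D) D = {end_out e D}) \<longleftrightarrow> Q"
        unfolding Q_def by (intro bex_cong) simp_all
    qed
    finally show ?thesis .
  qed
  moreover have "weak_edge T e \<longleftrightarrow> P \<and> \<not> Q"
  proof
    assume "weak_edge T e"
    moreover obtain D where "D \<in> min_dominating_sets T"
      using ex_min_dominating_set fin by blast
    ultimately show "P \<and> \<not> Q"
      using meets unfolding weak_edge_def P_def Q_def by blast
  next
    assume "P \<and> \<not> Q"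
    \<comment> \<open>\<open>P\<close> gives a minimum dominating set at which the condition fails;
      it must avoid \<open>e\<close>, since otherwise it would witness \<open>Q\<close>.\<close>
    then obtain D0 where D0: "D0 \<in> min_dominating_sets T" "e \<inter> D0 = {}"
      unfolding P_def Q_def by blast
    have "e \<inter> D = {}" if D: "D \<in> min_dominating_sets T" for D
    proof (rule ccontr)
      assume "e \<inter> D \<noteq> {}"
      then have Q
        using tree_edge_exchange[OF T e' D0[unfolded uv] D] unfolding Q_def uv by auto
      then show False
        using \<open>P \<and> \<not> Q\<close> by simp
    qed
    then show "weak_edge T e"
      using e by (simp add: weak_edge_def)
  qed
  ultimately show ?thesis
    by blast
qed

theorem theorem8:
  fixes T :: "'a ugraph"
  assumes "is_tree T" and "2 \<le> card (verts T)"
  shows "SR_graph T \<longleftrightarrow> \<not> (\<exists>e. weak_edge T e) \<and> \<not> (\<exists>e. strong_edge T e)"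
proof -
  have "SR_graph T \<longleftrightarrow> (\<forall>e\<in>edges T. \<not> weak_edge T e \<and> \<not> strong_edge T e)"
    using assms tree_delete_eq_subdivide_iff[OF assms(1)]
    by (simp add: SR_graph_def is_tree_def)
  then show ?thesis
    by (auto simp: weak_edge_def strong_edge_def)
qed

end
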